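(* Let $n\geq 3$ and let $K_1,K_2\subset\mathbb{C}^n$ be strictly convex bodies, with $p_1$ an interior point of $K_1$ and $p_2$ an interior point of $K_2$. Suppose that for every complex linear hyperplane $H\subset\mathbb{C}^n$ (through the origin) the section $(H+p_1)\cap K_1$ is positively homothetic to $(H+p_2)\cap K_2$. Then $K_1$ is positively homothetic to $K_2$.
   Context: A convex body is a compact convex subset of $\mathbb{C}^n$ with nonempty interior; it is strictly convex if its boundary contains no nondegenerate real line segment. A set $A$ is positively homothetic to a set $B$ if $B=\lambda A+v$ for some real $\lambda>0$ and some $v\in\mathbb{C}^n$. Hyperplanes are complex hyperplanes (complex dimension $n-1$). *)

theory Defs
  imports "HOL-Analysis.Analysis"
begin

definition convex_body :: "'a::real_normed_vector set \<Rightarrow> bool" where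
  "convex_body K \<longleftrightarrow> compact K \<and> convex K \<and> interior K \<noteq> {}"

definition strictly_convex_body :: "'a::real_normed_vector set \<Rightarrow> bool" where
  "strictly_convex_body K \<longleftrightarrow> convex_body K \<and>
     (\<forall>x y. x \<noteq> y \<longrightarrow> \<not> closed_segment x y \<subseteq> frontier K)"

definition pos_homothetic :: "'a::real_vector set \<Rightarrow> 'a set \<Rightarrow> bool" where
  "pos_homothetic A B \<longleftrightarrow> (\<exists>c v. c > 0 \<and> B = (\<lambda>x. c *\<^sub>R x + v) ` A)"

definition complex_hyperplane :: "(complex ^ 'n) set \<Rightarrow> bool" where
  "complex_hyperplane H \<longleftrightarrow>
     (\<exists>a::complex ^ 'n. a \<noteq> 0 \<and> H = {z. (\<Sum>i\<in>UNIV. a $ i * z $ i) = 0})"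

end

theory Submission
  imports Defs
begin

text \<open>
  Translate so that both base points are the origin, and scale \<open>K2\<close> to the largest multiple \<open>L\<close>
  contained in \<open>K = K1\<close>, so that \<open>L\<close> touches the boundary of \<open>K\<close> at some \<open>y\<close>.  A section
  \<open>H \<inter> L \<subseteq> H \<inter> K\<close> through \<open>y\<close> is a homothetic copy with ratio at most \<open>1\<close>, and strict convexity
  forces the centre of the homothety to be \<open>y\<close>.  If some ratio is \<open>1\<close>, then this section meets every
  other one in at least two touching points, so all ratios are \<open>1\<close> and \<open>K = L\<close>.  Otherwise apply the
  same reasoning to the largest \<open>s K \<subseteq> L\<close>, touching at \<open>z\<close>.  In a section through both \<open>y\<close> and \<open>z\<close> the
  two descriptions of the homothety show that \<open>z\<close> is a negative multiple of \<open>y\<close>; hence every section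
  through \<open>y\<close> contains \<open>z\<close>, and comparing the two descriptions there shows that its ratio depends
  only on \<open>s\<close>, \<open>y\<close> and \<open>z\<close>.  One homothety with centre \<open>y\<close> therefore works for all sections
  through \<open>y\<close>, and these cover the space.
\<close>

section \<open>Homotheties and their effect on interiors, segments and strict convexity\<close>

lemma homothety_image_decomp:
  fixes S :: "'a::real_vector set"
  shows "(\<lambda>x. c *\<^sub>R x + v) ` S = (+) v ` (*\<^sub>R) c ` S"
  by (simp add: image_image add.commute)

lemma interior_homothety:
  fixes S :: "'a::euclidean_space set"
  assumes "c \<noteq> 0"
  shows "interior ((\<lambda>x. c *\<^sub>R x + v) ` S) = (\<lambda>x. c *\<^sub>R x + v) ` interior S"
proof -
  have "interior ((*\<^sub>R) c ` S) = (*\<^sub>R) c ` interior S"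
    by (rule interior_injective_linear_image) (use assms in \<open>auto simp: inj_on_def linear_scaleR\<close>)
  then show ?thesis
    unfolding homothety_image_decomp by (simp add: interior_translation)
qed

lemma inj_homothety:
  fixes v :: "'a::real_vector"
  shows "c \<noteq> 0 \<Longrightarrow> inj (\<lambda>x. c *\<^sub>R x + v)"
  by (auto simp: inj_on_def)

lemma closed_segment_homothety:
  fixes v :: "'a::real_vector"
  shows "closed_segment (c *\<^sub>R x + v) (c *\<^sub>R y + v) = (\<lambda>x. c *\<^sub>R x + v) ` closed_segment x y"
  unfolding homothety_image_decomp
  by (metis add.commute closed_segment_linear_image closed_segment_translation linear_scaleR)

lemma strictly_convex_body_homothety:
  fixes S :: "'a::euclidean_space set"
  assumes S: "strictly_convex_body S" and c: "c \<noteq> 0"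
  shows "strictly_convex_body ((\<lambda>x. c *\<^sub>R x + v) ` S)" (is "strictly_convex_body (?f ` S)")
proof -
  have cpt: "compact S" and cvx: "convex S" and int: "interior S \<noteq> {}"
    and seg: "\<And>x y. x \<noteq> y \<Longrightarrow> \<not> closed_segment x y \<subseteq> frontier S"
    using S by (auto simp: strictly_convex_body_def convex_body_def)
  have cpt': "compact (?f ` S)"
    by (intro compact_continuous_image continuous_intros cpt)
  have cvx': "convex (?f ` S)"
    unfolding homothety_image_decomp
    by (intro convex_translation convex_scaling cvx)
  have fr: "frontier (?f ` S) = ?f ` frontier S"
    using cpt cpt'
    by (simp add: frontier_def compact_imp_closed interior_homothety[OF c]
        image_set_diff[OF inj_homothety[OF c]])
  have "\<not> closed_segment x y \<subseteq> frontier (?f ` S)" if "x \<noteq> y" for x y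
  proof
    assume sub: "closed_segment x y \<subseteq> frontier (?f ` S)"
    define x' where "x' = (1/c) *\<^sub>R (x - v)"
    define y' where "y' = (1/c) *\<^sub>R (y - v)"
    have eq: "x = ?f x'" "y = ?f y'"
      using c by (auto simp: x'_def y'_def)
    have "?f ` closed_segment x' y' \<subseteq> ?f ` frontier S"
      using sub unfolding fr eq closed_segment_homothety .
    then have "closed_segment x' y' \<subseteq> frontier S"
      using inj_image_subset_iff[OF inj_homothety[OF c]] by blast
    moreover have "x' \<noteq> y'"
      using that eq by auto
    ultimately show False
      using seg by blast
  qed
  then show ?thesis
    using cpt' cvx' int
    by (simp add: strictly_convex_body_def convex_body_def interior_homothety[OF c])
qed

lemma pos_homothetic_homothety:
  "c > 0 \<Longrightarrow> pos_homothetic A ((\<lambda>x. c *\<^sub>R x + v) ` A)"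
  unfolding pos_homothetic_def by blast

lemma pos_homothetic_sym:
  assumes "pos_homothetic A B"
  shows "pos_homothetic B A"
proof -
  obtain c v where "c > 0" and B: "B = (\<lambda>x. c *\<^sub>R x + v) ` A"
    using assms unfolding pos_homothetic_def by blast
  have "A = (\<lambda>x. (1/c) *\<^sub>R x + (- (1/c)) *\<^sub>R v) ` B"
    using \<open>c > 0\<close> unfolding B by (simp add: image_image scaleR_add_right)
  moreover have "1/c > 0"
    using \<open>c > 0\<close> by simp
  ultimately show ?thesis
    unfolding pos_homothetic_def by blast
qed

lemma pos_homothetic_trans:
  assumes "pos_homothetic A B" "pos_homothetic B C"
  shows "pos_homothetic A C"
proof -
  obtain c v where c: "c > 0" and B: "B = (\<lambda>x. c *\<^sub>R x + v) ` A"
    using assms(1) unfolding pos_homothetic_def by blast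
  obtain d w where d: "d > 0" and C: "C = (\<lambda>x. d *\<^sub>R x + w) ` B"
    using assms(2) unfolding pos_homothetic_def by blast
  have "C = (\<lambda>x. (d * c) *\<^sub>R x + (d *\<^sub>R v + w)) ` A"
    unfolding B C by (simp add: image_image scaleR_add_right add.assoc)
  moreover have "d * c > 0"
    using c d by simp
  ultimately show ?thesis
    unfolding pos_homothetic_def by blast
qed

section \<open>Touching points in strictly convex bodies\<close>

text \<open>If \<open>b\<close> and \<open>p\<close> differed, their segment would contain an
  interior point \<open>q\<close>. Everything between \<open>q\<close> and either end, apart from
  that end itself, is then interior, which covers the whole open segment.\<close>

lemma strictly_convex_body_combination_frontier:
  fixes K :: "'a::euclidean_space set"
  assumes K: "strictly_convex_body K" and b: "b \<in> K" and p: "p \<in> K"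
    and u: "0 < u" "u < 1" and y: "u *\<^sub>R b + (1 - u) *\<^sub>R p \<in> frontier K"
  shows "b = p"
proof (rule ccontr)
  assume "b \<noteq> p"
  have cl: "closed K" and cvx: "convex K"
    using K by (auto simp: strictly_convex_body_def convex_body_def compact_imp_closed)
  let ?y = "u *\<^sub>R b + (1 - u) *\<^sub>R p"
  obtain q where q: "q \<in> closed_segment b p" "q \<notin> frontier K"
    using K \<open>b \<noteq> p\<close> unfolding strictly_convex_body_def by blast
  have "q \<in> K"
    using q(1) closed_segment_subset[OF b p cvx] by blast
  then have int: "q \<in> interior K"
    using q(2) by (simp add: frontier_def closure_closed[OF cl])
  obtain w where w: "0 \<le> w" "w \<le> 1" "q = (1 - w) *\<^sub>R b + w *\<^sub>R p"
    using q(1) by (auto simp: in_segment)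
  \<comment> \<open>Measured from \<open>b\<close> to \<open>p\<close>, \<open>q\<close> has
    parameter \<open>w\<close> and \<open>?y\<close> has parameter \<open>1 - u\<close>. So
    \<open>?y\<close> lies between \<open>q\<close> and \<open>p\<close> or between \<open>b\<close>
    and \<open>q\<close>; the factors \<open>u / (1 - w)\<close> and \<open>(1 - u) / w\<close> are
    its distance from the end in question relative to that of \<open>q\<close>.\<close>
  have "?y \<in> interior K"
  proof (cases "w \<le> 1 - u")
    case True
    then have "p - (u / (1 - w)) *\<^sub>R (p - q) \<in> interior K"
      using u w p closure_closed[OF cl] by (intro mem_interior_closure_convex_shrink[OF cvx int]) auto
    moreover
    have "p - q = (1 - w) *\<^sub>R (p - b)"
      by (simp add: w(3) algebra_simps)
    then have "(u / (1 - w)) *\<^sub>R (p - q) = u *\<^sub>R (p - b)"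
      using True u by simp
    ultimately show ?thesis
      by (simp only:) (simp add: algebra_simps)
  next
    case False
    then have "b - ((1 - u) / w) *\<^sub>R (b - q) \<in> interior K"
      using u w b closure_closed[OF cl] by (intro mem_interior_closure_convex_shrink[OF cvx int]) auto
    moreover
    have "b - q = w *\<^sub>R (b - p)"
      by (simp add: w(3) algebra_simps)
    then have "((1 - u) / w) *\<^sub>R (b - q) = (1 - u) *\<^sub>R (b - p)"
      using False u by simp
    ultimately show ?thesis
      by (simp only:) (simp add: algebra_simps)
  qed
  then show False
    using y by (simp add: frontier_def)
qed

text \<open>Here \<open>B\<close> stands for a section, which may have empty interior, so strict
  convexity is taken from the ambient \<open>K\<close>. A contraction of \<open>B\<close> into
  itself has its centre in \<open>B\<close>, and a frontier point of \<open>K\<close> in the image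
  would lie strictly between the centre and another point of \<open>B\<close>, unless it is the
  centre.\<close>

lemma homothety_into_self_touching:
  fixes K B :: "'a::euclidean_space set"
  assumes K: "strictly_convex_body K" and "B \<subseteq> K" "compact B"
    and d: "d \<in> B" "d' \<in> B" "d \<noteq> d'"
    and c: "c > 0" and sub: "(\<lambda>x. c *\<^sub>R x + v) ` B \<subseteq> B"
    and y: "y \<in> (\<lambda>x. c *\<^sub>R x + v) ` B" "y \<in> frontier K"
  shows "c \<le> 1 \<and> v = (1 - c) *\<^sub>R y"
proof -
  let ?f = "\<lambda>x. c *\<^sub>R x + v"
  have dist_f: "dist (?f a) (?f b) = c * dist a b" for a b
    using c by (simp add: dist_norm flip: scaleR_diff_right)
  \<comment> \<open>The map multiplies distances by \<open>c\<close>, so with \<open>c > 1\<close> a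
    pair realising the diameter of \<open>B\<close> would be sent to a pair in \<open>B\<close> that
    is too far apart.\<close>
  have le1: "c \<le> 1"
  proof -
    have bd: "bounded B"
      using \<open>compact B\<close> by (rule compact_imp_bounded)
    obtain a b where ab: "a \<in> B" "b \<in> B" "dist a b = diameter B"
      using diameter_compact_attained[OF \<open>compact B\<close>] d by blast
    have "dist d d' \<le> diameter B"
      using diameter_bounded_bound[OF bd] d by blast
    then have pos: "diameter B > 0"
      using d by (smt (verit) zero_less_dist_iff)
    have "dist (?f a) (?f b) \<le> diameter B"
      using diameter_bounded_bound[OF bd] sub ab by blast
    then show ?thesis
      using pos by (simp only: dist_f ab) simp
  qed
  show ?thesis
  proof (cases "c = 1")
    case True
    \<comment> \<open>For ratio 1 the map is a translation. The point \<open>a\<close> of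
      \<open>B\<close> furthest in direction \<open>v\<close> has its translate \<open>a + v\<close>
      in \<open>B\<close>, which is further by \<open>v \<bullet> v\<close>; hence
      \<open>v = 0\<close>.\<close>
    obtain a where a: "a \<in> B" "\<And>x. x \<in> B \<Longrightarrow> v \<bullet> x \<le> v \<bullet> a"
      using continuous_attains_sup[OF \<open>compact B\<close>, of "\<lambda>x. v \<bullet> x"] d(1)
        continuous_on_inner[OF continuous_on_const continuous_on_id]
      by blast
    have "a + v \<in> B"
      using sub a(1) True by auto
    from a(2)[OF this] have "v \<bullet> v \<le> 0"
      by (simp add: inner_add_right)
    then have "v = 0"
      by (metis inner_gt_zero_iff not_less)
    then show ?thesis
      using True by simp
  next
    case False
    then have "c < 1"
      using le1 by simp
    \<comment> \<open>The fixed point is the centre, and it lies in \<open>B\<close> because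
      \<open>B\<close> is complete.\<close>
    have "\<exists>!x\<in>B. ?f x = x"
      by (rule Banach_fix[where c = c])
        (use \<open>compact B\<close> d c \<open>c < 1\<close> sub dist_f in \<open>auto simp: compact_imp_complete\<close>)
    then obtain p where p: "p \<in> B" "?f p = p"
      by blast
    then have v: "v = (1 - c) *\<^sub>R p"
      by (simp add: algebra_simps)
    obtain b where b: "b \<in> B" "y = c *\<^sub>R b + (1 - c) *\<^sub>R p"
      using y(1) v by auto
    then have "b = p"
      using strictly_convex_body_combination_frontier[OF K _ _ c \<open>c < 1\<close>] y(2) p(1) \<open>B \<subseteq> K\<close> by blast
    then have "y = p"
      using b(2) by (simp add: algebra_simps)
    then show ?thesis
      using v le1 by simp
  qed
qed

section \<open>Largest multiple of one body inside another\<close>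

text \<open>The admissible factors form a nonempty compact set, and at its maximum the multiple must
  touch, since a compact set inside the open interior leaves room to enlarge.\<close>

lemma largest_inscribed_multiple:
  fixes A B :: "'a::euclidean_space set"
  assumes A: "compact A" "0 \<in> interior A" and B: "compact B" "0 \<in> interior B"
  obtains s where "s > 0" "(\<lambda>x. s *\<^sub>R x) ` A \<subseteq> B" "(\<lambda>x. s *\<^sub>R x) ` A \<inter> frontier B \<noteq> {}"
proof -
  define S where "S = {s. 0 \<le> s \<and> (\<forall>x\<in>A. s *\<^sub>R x \<in> B)}"
  obtain e where e: "e > 0" "cball 0 e \<subseteq> A"
    using A(2) by (auto simp: mem_interior_cball)
  obtain e' where e': "e' > 0" "cball 0 e' \<subseteq> B"
    using B(2) by (auto simp: mem_interior_cball)
  obtain M where M: "M > 0" "\<And>x. x \<in> A \<Longrightarrow> norm x \<le> M"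
    using compact_imp_bounded[OF A(1)] by (meson bounded_pos)
  obtain N where N: "\<And>x. x \<in> B \<Longrightarrow> norm x \<le> N"
    using compact_imp_bounded[OF B(1)] by (meson bounded_pos)
  \<comment> \<open>This factor squeezes \<open>A\<close> into the ball of radius \<open>e'\<close>
    in \<open>B\<close>. It makes \<open>S\<close> nonempty and its maximum positive.\<close>
  have eM: "e' / M \<in> S"
  proof -
    have "(e' / M) *\<^sub>R x \<in> B" if "x \<in> A" for x
    proof (rule subsetD[OF e'(2)])
      have "(e' / M) * norm x \<le> (e' / M) * M"
        using M e' that by (intro mult_left_mono) auto
      then show "(e' / M) *\<^sub>R x \<in> cball 0 e'"
        using M e' by simp
    qed
    then show ?thesis
      using M e' by (simp add: S_def)
  qed
  \<comment> \<open>A vector of length \<open>e\<close> lies in \<open>A\<close>, so its multiples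
    in \<open>B\<close> bound the factors by \<open>N / e\<close>.\<close>
  obtain b :: 'a where b: "norm b = e"
    using vector_choose_size[of e] e by auto
  have "s \<le> N / e" if "s \<in> S" for s
  proof -
    have "s *\<^sub>R b \<in> B"
      using that b e by (auto simp: S_def)
    from N[OF this] show ?thesis
      using b e that by (simp add: S_def field_simps)
  qed
  then have "S \<subseteq> {0..N / e}"
    by (auto simp: S_def)
  then have bdS: "bounded S"
    using bounded_closed_interval bounded_subset by metis
  have "S = {0..} \<inter> (\<Inter>x\<in>A. (\<lambda>s. s *\<^sub>R x) -` B)"
    by (auto simp: S_def)
  also have "closed \<dots>"
    using compact_imp_closed[OF B(1)]
    by (intro closed_Int closed_INT ballI closed_atLeast continuous_closed_vimage) (auto intro!: continuous_intros)
  finally have cptS: "compact S"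
    using bdS by (simp add: compact_eq_bounded_closed)
  obtain s where s: "s \<in> S" "\<And>t. t \<in> S \<Longrightarrow> t \<le> s"
    using compact_attains_sup[OF cptS] eM by blast
  have "s > 0"
    using s(2)[OF eM] M e' by (smt (verit) divide_pos_pos)
  have sub: "(\<lambda>x. s *\<^sub>R x) ` A \<subseteq> B"
    using s(1) by (auto simp: S_def)
  have "(\<lambda>x. s *\<^sub>R x) ` A \<inter> frontier B \<noteq> {}"
  proof
    assume "(\<lambda>x. s *\<^sub>R x) ` A \<inter> frontier B = {}"
    then have "(\<lambda>x. s *\<^sub>R x) ` A \<subseteq> interior B"
      using sub closure_subset by (fastforce simp: frontier_def)
    then obtain d where d: "d > 0" "(\<Union>x\<in>(\<lambda>x. s *\<^sub>R x) ` A. ball x d) \<subseteq> interior B"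
      using compact_subset_open_imp_ball_epsilon_subset[OF compact_scaling[OF A(1)] open_interior] by metis
    \<comment> \<open>Raising the factor by \<open>r\<close> moves each point by at most
      \<open>d / 2\<close>, within the uniform margin \<open>d\<close>.\<close>
    define r where "r = d / (2 * M)"
    have "r > 0"
      using d M by (simp add: r_def)
    have "(s + r) *\<^sub>R x \<in> B" if x: "x \<in> A" for x
    proof -
      have "r * norm x \<le> r * M"
        using M(2)[OF x] \<open>r > 0\<close> by simp
      also have "\<dots> < d"
        using d M by (simp add: r_def)
      finally have "(s + r) *\<^sub>R x \<in> ball (s *\<^sub>R x) d"
        using \<open>r > 0\<close> by (simp add: dist_norm scaleR_add_left)
      then show ?thesis
        using d(2) x interior_subset by blast
    qed
    then have "s + r \<in> S"
      using \<open>s > 0\<close> \<open>r > 0\<close> by (simp add: S_def)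
    then show False
      using s(2) \<open>r > 0\<close> by fastforce
  qed
  then show ?thesis
    using that \<open>s > 0\<close> sub by blast
qed

section \<open>From homothetic central sections to homothetic bodies\<close>

text \<open>Of complex hyperplanes only three properties are kept: they are real subspaces, any two
  vectors lie in a common one, and any two of them share a nonzero vector. The inclusion and the
  touching are arranged beforehand by scaling.\<close>

lemma pos_homothetic_of_central_sections:
  fixes K L :: "'a::euclidean_space set" and \<H> :: "'a set set"
  assumes K: "strictly_convex_body K" "0 \<in> interior K"
    and L: "strictly_convex_body L" "0 \<in> interior L"
    and LK: "L \<subseteq> K" "L \<inter> frontier K \<noteq> {}"
    and subsp: "\<And>H. H \<in> \<H> \<Longrightarrow> subspace H"
    and cover: "\<And>x y. \<exists>H\<in>\<H>. x \<in> H \<and> y \<in> H"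
    and meet: "\<And>H H'. H \<in> \<H> \<Longrightarrow> H' \<in> \<H> \<Longrightarrow> \<exists>z. z \<noteq> 0 \<and> z \<in> H \<and> z \<in> H'"
    and hom: "\<And>H. H \<in> \<H> \<Longrightarrow> pos_homothetic (H \<inter> K) (H \<inter> L)"
  shows "pos_homothetic K L"
proof -
  have cpt: "compact K" "compact L"
    using K(1) L(1) by (auto simp: strictly_convex_body_def convex_body_def)
  have frK: "frontier K \<subseteq> K"
    using cpt by (simp add: compact_imp_closed frontier_subset_closed)
  have zeroK: "0 \<in> K" "0 \<notin> frontier K" and zeroL: "0 \<in> L"
    using K(2) L(2) interior_subset by (auto simp: frontier_def)
  have ray: "\<exists>x. x \<in> H \<and> x \<in> frontier M \<and> (\<exists>r>0. x = r *\<^sub>R z)"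
    if "subspace H" "z \<in> H" "z \<noteq> 0" "compact M" "0 \<in> interior M" for H z and M :: "'a set"
  proof -
    obtain r where "r > 0" "0 + r *\<^sub>R z \<in> frontier M"
      using ray_to_frontier[OF compact_imp_bounded[OF \<open>compact M\<close>] \<open>0 \<in> interior M\<close> \<open>z \<noteq> 0\<close>] .
    then show ?thesis
      using that by (intro exI[of _ "r *\<^sub>R z"]) (auto simp: subspace_scale)
  qed
  \<comment> \<open>Together with the origin this supplies the two distinct points required by
    \<open>homothety_into_self_touching\<close>.\<close>
  have two: "\<exists>d. d \<in> H \<inter> M \<and> d \<noteq> 0"
    if H: "H \<in> \<H>" and M: "compact M" "0 \<in> interior M" for H and M :: "'a set"
  proof -
    obtain z where z: "z \<noteq> 0" "z \<in> H"
      using meet[OF H H] by blast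
    then obtain x r where "x \<in> H" "x \<in> frontier M" "r > 0" "x = r *\<^sub>R z"
      using ray[OF subsp[OF H] z(2,1) M] by blast
    then show ?thesis
      using z frontier_subset_closed[OF compact_imp_closed[OF M(1)]]
      by (intro exI[of _ x]) auto
  qed
  \<comment> \<open>The pair \<open>c\<close>, \<open>v\<close> is chosen before \<open>y\<close>,
    so that two touching points in one section are subject to the same equation.\<close>
  have ratio: "\<exists>c v. 0 < c \<and> c \<le> 1 \<and> H \<inter> L = (\<lambda>x. c *\<^sub>R x + v) ` (H \<inter> K)
      \<and> (\<forall>y \<in> H \<inter> L \<inter> frontier K. v = (1 - c) *\<^sub>R y)"
    if H: "H \<in> \<H>" and ne: "H \<inter> L \<inter> frontier K \<noteq> {}" for H
  proof -
    obtain c v where c: "c > 0" and eq: "H \<inter> L = (\<lambda>x. c *\<^sub>R x + v) ` (H \<inter> K)"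
      using hom[OF H] unfolding pos_homothetic_def by blast
    obtain d where d: "d \<in> H \<inter> K" "d \<noteq> 0"
      using two[OF H cpt(1) K(2)] by blast
    have "compact (H \<inter> K)"
      using closed_subspace[OF subsp[OF H]] cpt(1) by (rule closed_Int_compact)
    moreover have "0 \<in> H \<inter> K"
      using zeroK subspace_0[OF subsp[OF H]] by blast
    moreover have "(\<lambda>x. c *\<^sub>R x + v) ` (H \<inter> K) \<subseteq> H \<inter> K"
      unfolding eq[symmetric] using LK by blast
    ultimately have "c \<le> 1 \<and> v = (1 - c) *\<^sub>R y" if "y \<in> H \<inter> L \<inter> frontier K" for y
      using homothety_into_self_touching[OF K(1) _ _ d(1) _ d(2) c, where v = v and y = y] that eq by auto
    then show ?thesis
      using c eq ne by blast
  qed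
  obtain y where y: "y \<in> L" "y \<in> frontier K"
    using LK(2) by blast
  have "y \<noteq> 0"
    using y zeroK by auto
  \<comment> \<open>Equality of sections encodes ratio 1: at a touching point \<open>y\<close> the
    shift \<open>(1 - c) *\<^sub>R y\<close> vanishes when \<open>c = 1\<close>.\<close>
  show ?thesis
  proof (cases "\<exists>H\<in>\<H>. H \<inter> L = H \<inter> K")
    case True
    then obtain H where H: "H \<in> \<H>" "H \<inter> L = H \<inter> K"
      by blast
    have "x \<in> L" if "x \<in> K" for x
    proof -
      obtain H' where H': "H' \<in> \<H>" "x \<in> H'"
        using cover by blast
      \<comment> \<open>The rays along \<open>z\<close> and \<open>- z\<close> meet the frontier of
        \<open>K\<close> in \<open>a\<close> and \<open>b\<close>. Both lie in
        \<open>H \<inter> K = H \<inter> L\<close>, so they are distinct touching points in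
        \<open>H'\<close> as well, and \<open>(1 - c) *\<^sub>R a = (1 - c) *\<^sub>R b\<close>
        gives \<open>c = 1\<close>.\<close>
      obtain z where z: "z \<noteq> 0" "z \<in> H \<inter> H'"
        using meet[OF H(1) H'(1)] by blast
      have sHH: "subspace (H \<inter> H')"
        using subsp H H' by (simp add: subspace_inter)
      obtain a r where a: "a \<in> H \<inter> H'" "a \<in> frontier K" "r > 0" "a = r *\<^sub>R z"
        using ray[OF sHH z(2,1) cpt(1) K(2)] by blast
      have mz: "- z \<in> H \<inter> H'" "- z \<noteq> 0"
        using z subspace_neg[OF sHH] by simp_all
      obtain b t where b: "b \<in> H \<inter> H'" "b \<in> frontier K" "t > 0" "b = t *\<^sub>R - z"
        using ray[OF sHH mz cpt(1) K(2)] by blast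
      have "a - b = (r + t) *\<^sub>R z"
        using a b by (simp add: algebra_simps)
      then have "a \<noteq> b"
        using a(3) b(3) z(1) by auto
      have ab: "a \<in> H' \<inter> L \<inter> frontier K" "b \<in> H' \<inter> L \<inter> frontier K"
        using a b H(2) frK by blast+
      then obtain c v where c: "H' \<inter> L = (\<lambda>x. c *\<^sub>R x + v) ` (H' \<inter> K)"
        "v = (1 - c) *\<^sub>R a" "v = (1 - c) *\<^sub>R b"
        using ratio[OF H'(1)] by blast
      then have "c = 1"
        using \<open>a \<noteq> b\<close> by (metis diff_eq_diff_eq diff_self eq_iff_diff_eq_0 scaleR_cancel_left)
      then have "H' \<inter> L = H' \<inter> K"
        using c by simp
      then show ?thesis
        using that H' by blast
    qed
    then have "L = (\<lambda>x. 1 *\<^sub>R x + 0) ` K"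
      using LK by auto
    then show ?thesis
      by (metis pos_homothetic_homothety zero_less_one)
  next
    case False
    have atY: "\<exists>c. 0 < c \<and> c < 1 \<and> H \<inter> L = (\<lambda>x. c *\<^sub>R x + (1 - c) *\<^sub>R y) ` (H \<inter> K)"
      if H: "H \<in> \<H>" "y \<in> H" for H
    proof -
      have yH: "y \<in> H \<inter> L \<inter> frontier K"
        using H(2) y by blast
      obtain c v where "0 < c" "c \<le> 1" "H \<inter> L = (\<lambda>x. c *\<^sub>R x + v) ` (H \<inter> K)" "v = (1 - c) *\<^sub>R y"
        using ratio[OF H(1)] yH by blast
      then have c: "0 < c" "c \<le> 1" "H \<inter> L = (\<lambda>x. c *\<^sub>R x + (1 - c) *\<^sub>R y) ` (H \<inter> K)"
        by simp_all
      then have "c \<noteq> 1"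
        using False H by auto
      then show ?thesis
        using c by auto
    qed
    obtain s where s: "s > 0" "(\<lambda>x. s *\<^sub>R x) ` K \<subseteq> L" "(\<lambda>x. s *\<^sub>R x) ` K \<inter> frontier L \<noteq> {}"
      using largest_inscribed_multiple[OF cpt(1) K(2) cpt(2) L(2)] .
    then obtain z0 where z0: "z0 \<in> K" "s *\<^sub>R z0 \<in> frontier L"
      by blast
    define z where "z = s *\<^sub>R z0"
    have atZ: "s < c \<and> (c - s) *\<^sub>R z = - (s * (1 - c)) *\<^sub>R y"
      if H: "H \<in> \<H>" "z \<in> H" and c: "0 < c" "c < 1"
        and eq: "H \<inter> L = (\<lambda>x. c *\<^sub>R x + (1 - c) *\<^sub>R y) ` (H \<inter> K)" for H c
    proof -
      \<comment> \<open>Undoing the homothety with centre \<open>y\<close> and then scaling by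
        \<open>s\<close> maps \<open>H \<inter> L\<close> onto \<open>s\<close> times
        \<open>H \<inter> K\<close>, inside \<open>H \<inter> L\<close>. This composite has ratio
        \<open>s / c\<close> and shift \<open>?w\<close>; since \<open>z\<close> is a touching point
        in \<open>L\<close>, also \<open>?w = (1 - s / c) *\<^sub>R z\<close>.\<close>
      let ?w = "- (s / c * (1 - c)) *\<^sub>R y"
      have "(s / c) *\<^sub>R (c *\<^sub>R x + (1 - c) *\<^sub>R y) + ?w = s *\<^sub>R x" for x
        using c by (simp add: scaleR_add_right)
      then have im: "(\<lambda>x. (s / c) *\<^sub>R x + ?w) ` (H \<inter> L) = (\<lambda>x. s *\<^sub>R x) ` (H \<inter> K)"
        unfolding eq image_image by simp
      have sub: "(\<lambda>x. s *\<^sub>R x) ` (H \<inter> K) \<subseteq> H \<inter> L"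
        using s(2) subspace_scale[OF subsp[OF H(1)]] by blast
      have "(1 / s) *\<^sub>R z \<in> H"
        using H subspace_scale[OF subsp[OF H(1)]] by blast
      then have "z0 \<in> H"
        using s by (simp add: z_def)
      then have zin: "z \<in> (\<lambda>x. s *\<^sub>R x) ` (H \<inter> K)"
        using z0(1) unfolding z_def by blast
      obtain d where d: "d \<in> H \<inter> L" "d \<noteq> 0"
        using two[OF H(1) cpt(2) L(2)] by blast
      have "compact (H \<inter> L)"
        using closed_subspace[OF subsp[OF H(1)]] cpt(2) by (rule closed_Int_compact)
      moreover have "0 \<in> H \<inter> L"
        using zeroL subspace_0[OF subsp[OF H(1)]] by blast
      moreover have "s / c > 0"
        using s c by simp
      ultimately have A: "s / c \<le> 1" "?w = (1 - s / c) *\<^sub>R z"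
        using homothety_into_self_touching[OF L(1) _ _ d(1) _ d(2),
            where c = "s / c" and v = ?w and y = z] im sub zin z0(2)
        by (auto simp: z_def)
      \<comment> \<open>Ratio 1 would give \<open>?w = 0\<close>, but \<open>?w\<close> is a nonzero
        multiple of \<open>y\<close>.\<close>
      have "s / c \<noteq> 1"
        using A(2) \<open>y \<noteq> 0\<close> s c by auto
      then have "s < c"
        using A(1) c by (simp add: field_simps)
      moreover have "(c - s) *\<^sub>R z = - (s * (1 - c)) *\<^sub>R y"
      proof -
        have "c *\<^sub>R ?w = c *\<^sub>R (1 - s / c) *\<^sub>R z"
          using A(2) by simp
        moreover have "c * (1 - s / c) = c - s" "c * - (s / c * (1 - c)) = - (s * (1 - c))"
          using c by (simp_all add: field_simps)
        ultimately show ?thesis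
          by (simp only: scaleR_scaleR)
      qed
      ultimately show ?thesis
        by simp
    qed
    obtain H0 where H0: "H0 \<in> \<H>" "y \<in> H0" "z \<in> H0"
      using cover by blast
    then obtain c0 where c0: "0 < c0" "c0 < 1"
      "H0 \<inter> L = (\<lambda>x. c0 *\<^sub>R x + (1 - c0) *\<^sub>R y) ` (H0 \<inter> K)"
      using atY by blast
    then have z0': "s < c0" "(c0 - s) *\<^sub>R z = - (s * (1 - c0)) *\<^sub>R y"
      using atZ[OF H0(1,3)] by auto
    \<comment> \<open>Obtained by solving the relation in \<open>H0\<close> for \<open>z\<close>; it
      is positive because \<open>s < c0 < 1\<close>.\<close>
    define k where "k = s * (1 - c0) / (c0 - s)"
    have "k > 0"
      using s c0 z0' by (simp add: k_def)
    have zk: "z = - k *\<^sub>R y"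
    proof -
      have "z = (1 / (c0 - s)) *\<^sub>R (c0 - s) *\<^sub>R z"
        using z0'(1) by simp
      also have "\<dots> = - k *\<^sub>R y"
        unfolding z0'(2) by (simp add: k_def)
      finally show ?thesis .
    qed
    \<comment> \<open>Putting \<open>z = - k *\<^sub>R y\<close> into the relation of
      \<open>atZ\<close> gives \<open>(c - s) * k = s * (1 - c)\<close>, whose only solution
      \<open>c\<close> is \<open>l\<close>.\<close>
    define l where "l = s * (1 + k) / (k + s)"
    have "l > 0"
      using s \<open>k > 0\<close> by (simp add: l_def)
    have all: "H \<inter> L = (\<lambda>x. l *\<^sub>R x + (1 - l) *\<^sub>R y) ` (H \<inter> K)" if H: "H \<in> \<H>" "y \<in> H" for H
    proof -
      obtain c where c: "0 < c" "c < 1" "H \<inter> L = (\<lambda>x. c *\<^sub>R x + (1 - c) *\<^sub>R y) ` (H \<inter> K)"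
        using atY[OF H] by blast
      have "z \<in> H"
        unfolding zk using H subspace_scale[OF subsp[OF H(1)]] by blast
      then have "(c - s) *\<^sub>R z = - (s * (1 - c)) *\<^sub>R y"
        using atZ[OF H(1) _ c] by blast
      then have "(c - s) * k = s * (1 - c)"
        using \<open>y \<noteq> 0\<close> by (simp add: zk)
      then have "c * (k + s) = s * (1 + k)"
        by (simp add: algebra_simps)
      then have "c = l"
        using s \<open>k > 0\<close> by (simp add: l_def field_simps)
      then show ?thesis
        using c(3) by simp
    qed
    have "L = (\<lambda>x. l *\<^sub>R x + (1 - l) *\<^sub>R y) ` K"
    proof (intro set_eqI iffI)
      fix x
      assume "x \<in> L"
      moreover obtain H where "H \<in> \<H>" "x \<in> H" "y \<in> H"
        using cover by blast
      ultimately show "x \<in> (\<lambda>x. l *\<^sub>R x + (1 - l) *\<^sub>R y) ` K"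
        using all by blast
    next
      fix x
      assume "x \<in> (\<lambda>x. l *\<^sub>R x + (1 - l) *\<^sub>R y) ` K"
      then obtain x' where x': "x' \<in> K" "x = l *\<^sub>R x' + (1 - l) *\<^sub>R y"
        by blast
      obtain H where "H \<in> \<H>" "x' \<in> H" "y \<in> H"
        using cover by blast
      then show "x \<in> L"
        using all x' by blast
    qed
    then show ?thesis
      using pos_homothetic_homothety[OF \<open>l > 0\<close>] by metis
  qed
qed

section \<open>Complex hyperplanes in dimension at least three\<close>

text \<open>A square matrix with rows \<open>x\<close> and \<open>y\<close> and all others zero has
  a zero row once there are three indices, hence a nontrivial kernel. As the pairing is symmetric,
  this yields both a hyperplane through two given vectors and a nonzero vector common to two given
  hyperplanes.\<close>

lemma exists_common_annihilator:
  fixes x y :: "'a::field ^ 'n"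
  assumes "CARD('n) \<ge> 3"
  shows "\<exists>a. a \<noteq> 0 \<and> (\<Sum>i\<in>UNIV. a $ i * x $ i) = 0 \<and> (\<Sum>i\<in>UNIV. a $ i * y $ i) = 0"
proof -
  obtain T :: "'n set" where "card T = 3"
    using obtain_subset_with_card_n[OF assms] by blast
  then obtain i j k :: 'n where ij: "i \<noteq> j" "k \<noteq> i" "k \<noteq> j"
    by (auto simp: card_3_iff)
  define A :: "'a^'n^'n" where "A = (\<chi> r. if r = i then x else if r = j then y else 0)"
  have "row k A = 0"
    using ij by (simp add: A_def row_def vec_eq_iff)
  then have "\<not> invertible A"
    using det_zero_row(2) invertible_det_nz by blast
  then obtain a where a: "a \<noteq> 0" "A *v a = 0"
    by (auto simp: invertible_left_inverse matrix_left_invertible_ker)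
  have "(A *v a) $ i = 0" "(A *v a) $ j = 0"
    using a by simp_all
  then have "(\<Sum>r\<in>UNIV. x $ r * a $ r) = 0" "(\<Sum>r\<in>UNIV. y $ r * a $ r) = 0"
    using ij by (simp_all add: matrix_vector_mult_def A_def)
  then show ?thesis
    using a(1) by (auto simp: mult.commute)
qed

lemma subspace_complex_hyperplane:
  assumes "complex_hyperplane H"
  shows "subspace H"
proof -
  obtain a where H: "H = {z. (\<Sum>i\<in>UNIV. a $ i * z $ i) = 0}"
    using assms unfolding complex_hyperplane_def by blast
  show ?thesis
    unfolding H subspace_def
    by (auto simp: algebra_simps sum.distrib simp flip: scaleR_sum_right)
qed

section \<open>Normalisation by translation and scaling\<close>

theorem theorem2p2:
  fixes K1 K2 :: "(complex ^ 'n) set" and p1 p2 :: "complex ^ 'n"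
  assumes "CARD('n) \<ge> 3"
    and "strictly_convex_body K1" and "strictly_convex_body K2"
    and "p1 \<in> interior K1" and "p2 \<in> interior K2"
    and "\<And>H. complex_hyperplane H \<Longrightarrow>
           pos_homothetic (((\<lambda>h. h + p1) ` H) \<inter> K1) (((\<lambda>h. h + p2) ` H) \<inter> K2)"
  shows "pos_homothetic K1 K2"
proof -
  \<comment> \<open>The translations are written as homotheties of ratio 1 so that the homothety
    lemmas apply directly; the \<open>+ 0\<close> in \<open>L\<close> below has the same
    purpose.\<close>
  define K where "K = (\<lambda>x. 1 *\<^sub>R x + - p1) ` K1"
  define M where "M = (\<lambda>x. 1 *\<^sub>R x + - p2) ` K2"
  have K: "strictly_convex_body K" "0 \<in> interior K"
    using strictly_convex_body_homothety[OF assms(2), of 1 "- p1"]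
      interior_homothety[of 1 "- p1" K1] assms(4)
    by (simp_all add: K_def)
  have M: "strictly_convex_body M" "0 \<in> interior M"
    using strictly_convex_body_homothety[OF assms(3), of 1 "- p2"]
      interior_homothety[of 1 "- p2" K2] assms(5)
    by (simp_all add: M_def)
  have cpt: "compact K" "compact M"
    using K M by (auto simp: strictly_convex_body_def convex_body_def)
  obtain s where s: "s > 0" "(\<lambda>x. s *\<^sub>R x) ` M \<subseteq> K" "(\<lambda>x. s *\<^sub>R x) ` M \<inter> frontier K \<noteq> {}"
    using largest_inscribed_multiple[OF cpt(2) M(2) cpt(1) K(2)] .
  define L where "L = (\<lambda>x. s *\<^sub>R x + 0) ` M"
  have L: "strictly_convex_body L" "0 \<in> interior L"
    using strictly_convex_body_homothety[OF M(1), of s 0] interior_homothety[of s 0 M] M(2) s(1)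
    by (force simp: L_def)+
  have L2: "L = (\<lambda>x. s *\<^sub>R x + - s *\<^sub>R p2) ` K2"
    by (simp add: L_def M_def image_image scaleR_diff_right)
  have "pos_homothetic K L"
  proof (rule pos_homothetic_of_central_sections[OF K L, where \<H> = "Collect complex_hyperplane"])
    show "L \<subseteq> K" "L \<inter> frontier K \<noteq> {}"
      using s by (simp_all add: L_def)
    show "subspace H" if "H \<in> Collect complex_hyperplane" for H :: "(complex ^ 'n) set"
      using that subspace_complex_hyperplane by blast
    show "\<exists>H\<in>Collect complex_hyperplane. x \<in> H \<and> y \<in> H" for x y :: "complex ^ 'n"
    proof -
      obtain a where a: "a \<noteq> 0" "(\<Sum>i\<in>UNIV. a $ i * x $ i) = 0" "(\<Sum>i\<in>UNIV. a $ i * y $ i) = 0"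
        using exists_common_annihilator[OF assms(1), of x y] by blast
      have "complex_hyperplane {z. (\<Sum>i\<in>UNIV. a $ i * z $ i) = 0}"
        using a(1) unfolding complex_hyperplane_def by blast
      then show ?thesis
        using a by (intro bexI[where x = "{z. (\<Sum>i\<in>UNIV. a $ i * z $ i) = 0}"]) auto
    qed
    show "\<exists>z. z \<noteq> 0 \<and> z \<in> H \<and> z \<in> H'"
      if HH: "H \<in> Collect complex_hyperplane" "H' \<in> Collect complex_hyperplane"
      for H H' :: "(complex ^ 'n) set"
    proof -
      \<comment> \<open>Now the coefficient vectors \<open>a\<close> and \<open>b\<close> are the
        given pair, and their annihilator is the common vector.\<close>
      obtain a b where "H = {z. (\<Sum>i\<in>UNIV. a $ i * z $ i) = 0}"
        "H' = {z. (\<Sum>i\<in>UNIV. b $ i * z $ i) = 0}"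
        using HH unfolding complex_hyperplane_def by blast
      then show ?thesis
        using exists_common_annihilator[OF assms(1), of a b] by (simp add: mult.commute)
    qed
    show "pos_homothetic (H \<inter> K) (H \<inter> L)" if "H \<in> Collect complex_hyperplane" for H
    proof -
      have H: "complex_hyperplane H" and sH: "subspace H"
        using that subspace_complex_hyperplane by auto
      \<comment> \<open>Because \<open>H\<close> is invariant under scaling by \<open>s\<close>,
        cutting with \<open>H\<close> commutes with passing from \<open>M\<close> to
        \<open>L\<close>.\<close>
      have scale: "s *\<^sub>R h \<in> H \<longleftrightarrow> h \<in> H" for h
        using subspace_scale[OF sH, of h s] subspace_scale[OF sH, of "s *\<^sub>R h" "1/s"] s(1) by auto
      have "H \<inter> K = (\<lambda>x. 1 *\<^sub>R x + - p1) ` (((\<lambda>h. h + p1) ` H) \<inter> K1)"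
        by (force simp: K_def)
      then have 1: "pos_homothetic (((\<lambda>h. h + p1) ` H) \<inter> K1) (H \<inter> K)"
        by (metis pos_homothetic_homothety zero_less_one)
      have "H \<inter> L = (\<lambda>x. s *\<^sub>R x + - s *\<^sub>R p2) ` (((\<lambda>h. h + p2) ` H) \<inter> K2)"
      proof (intro set_eqI iffI)
        fix x
        assume "x \<in> H \<inter> L"
        then obtain q where q: "q \<in> K2" "x = s *\<^sub>R (q - p2)" "x \<in> H"
          by (auto simp: L2 scaleR_diff_right)
        then have "q - p2 \<in> H"
          using scale by simp
        then have "q \<in> (\<lambda>h. h + p2) ` H"
          by (metis diff_add_cancel image_eqI)
        then show "x \<in> (\<lambda>x. s *\<^sub>R x + - s *\<^sub>R p2) ` (((\<lambda>h. h + p2) ` H) \<inter> K2)"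
          using q by (auto simp: scaleR_diff_right)
      next
        fix x
        assume "x \<in> (\<lambda>x. s *\<^sub>R x + - s *\<^sub>R p2) ` (((\<lambda>h. h + p2) ` H) \<inter> K2)"
        then obtain h where "h \<in> H" "h + p2 \<in> K2" "x = s *\<^sub>R (h + p2) + - s *\<^sub>R p2"
          by blast
        then show "x \<in> H \<inter> L"
          using scale by (auto simp: L2 scaleR_add_right intro!: image_eqI[of _ _ "h + p2"])
      qed
      then have 2: "pos_homothetic (((\<lambda>h. h + p2) ` H) \<inter> K2) (H \<inter> L)"
        using pos_homothetic_homothety[OF s(1)] by metis
      show ?thesis
        using 1 2 assms(6)[OF H] pos_homothetic_sym pos_homothetic_trans by blast
    qed
  qed
  moreover have "pos_homothetic K1 K" "pos_homothetic K2 L"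
    unfolding K_def L2 using s(1) by (simp_all only: pos_homothetic_homothety zero_less_one)
  ultimately show ?thesis
    using pos_homothetic_sym pos_homothetic_trans by blast
qed

end
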